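(* Let $f\in C^2(\mathbb{R}^N,\mathbb{R})$ and consider the Hessian driven damping second order system $$\ddot{x}(t)+\frac{\alpha}{t}\dot{x}(t)+\frac{\lambda(t)}{\gamma}\nabla^2 f(x(t))\dot{x}(t) = -\frac{1}{\gamma^2}\left(\omega(t)-\tilde{\gamma}(t)\right)\nabla f(x(t)) - \nabla f\big(\mathcal{A}(t,x(t),\dot{x}(t))\big),$$ where $\lambda$, $\tilde{\gamma}$ and $\omega$ are given real functions of $t$ and $$\mathcal{A}(t,x,v) = x+\gamma\left(1-\frac{\alpha\gamma}{t}\right)v - \gamma\lambda(t)\nabla^2 f(x)v - \omega(t)\nabla f(x).$$ Then the Lie-Trotter splitting discretization of this system, with a forward Euler method on the first subproblem $(P_1)$ and the symplectic Euler integrator on the second subproblem $(P_2)$ (as described in the context, with $\gamma=h$, $t_n=nh$ and with the Hessian term approximated by a difference of two consecutive gradients), leads to the following algorithm: for every $n\ge1$, $$y_n = x_n+\alpha_n(x_n-x_{n-1})-\lambda_n\left[\nabla f(x_n)-\nabla f(x_{n-1})\right]-\omega_n\nabla f(x_n), \qquad x_{n+1}=y_n-h^2\nabla f(y_n)+\gamma_n\nabla f(x_n),$$ with $\alpha_n=1-\frac{\alpha}{n}$, $\lambda_n=\lambda(t_n)$, $\omega_n=\omega(t_n)$, $\gamma_n=\tilde{\gamma}(t_n)$.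
   Context: Here $\alpha$ is a real parameter, $h>0$ is the stepsize, $\gamma=h$, $t_n=nh$, $\alpha_n=1-\frac{\alpha h}{t_n}=1-\frac{\alpha}{n}$. With $v=\dot{x}$, the system is split into $(P_1)$: $\dot{x}=0$, $\ \dot{v}=-\frac{\alpha}{t}v-\frac{\lambda(t)}{\gamma}\nabla^2 f(x)v-\frac{\omega(t)}{\gamma^2}\nabla f(x)+\frac{\tilde{\gamma}(t)}{\gamma^2}\nabla f(x)-\nabla f(\mathcal{A}(t,x,v))+\nabla f(x)$ (non-potential forces); $(P_2)$: $\dot{x}=v$, $\ \dot{v}=-\nabla f(x)$ (potential forces). Given $x_0,x_1\in\mathbb{R}^N$, and $v_1=\frac{x_1-x_0}{h}$, one step of the scheme, for $n\ge1$, is: first an explicit forward Euler step of size $h$ at time $t_n$ for $(P_1)$ from $(x_n,v_n)$, giving $(x_{n+1/2},v_{n+1/2})$, i.e. $x_{n+1/2}=x_n$ and $$v_{n+1/2}=v_n+h\left(-\tfrac{\alpha}{t_n}v_n-\tfrac{\lambda_n}{h}\nabla^2 f(x_n)v_n-\tfrac{\omega_n}{h^2}\nabla f(x_n)+\tfrac{\gamma_n}{h^2}\nabla f(x_n)-\nabla f(\mathcal{A}(t_n,x_n,v_n))+\nabla f(x_n)\right),$$ in which every occurrence of $\nabla^2 f(x_n)v_n$ (including the one inside $\mathcal{A}(t_n,x_n,v_n)$) is replaced by the approximation $\frac{1}{h}\left[\nabla f(x_n)-\nabla f(x_{n-1})\right]$; then a symplectic Euler step of size $h$ for $(P_2)$: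 $$v_{n+1}=v_{n+1/2}-h\nabla f(x_{n+1/2}),\qquad x_{n+1}=x_{n+1/2}+h v_{n+1}.$$ The Lie-Trotter splitting solution after the step is $(x_{n+1},v_{n+1})$. The resulting algorithm is called LT-S-IGAHD (Lie-Trotter-Symplectic-IGAHD). *)

theory Defs
  imports "HOL-Analysis.Analysis"
begin

definition grad :: "(real^'n \<Rightarrow> real) \<Rightarrow> real^'n \<Rightarrow> real^'n" where
  "grad f x = (THE D. GDERIV f x :> D)"

definition hessian :: "(real^'n \<Rightarrow> real) \<Rightarrow> real^'n \<Rightarrow> real^'n^'n" where
  "hessian f x = jacobian (grad f) (at x)"

definition C2 :: "(real^'n \<Rightarrow> real) \<Rightarrow> bool" where
  "C2 f \<longleftrightarrow> (\<forall>x. f differentiable (at x)) \<and>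
     (\<forall>x. grad f differentiable (at x)) \<and> continuous_on UNIV (hessian f)"

definition hess_action :: "(real^'n \<Rightarrow> real) \<Rightarrow> real^'n \<Rightarrow> real^'n \<Rightarrow> real^'n" where
  "hess_action f x v = hessian f x *v v"

(* The argument H stands for the map (x, v) |-> Hessian of f at x applied to v. It is a parameter
   because the numerical scheme replaces this product, wherever it occurs, by a difference of
   gradients; the continuous system uses H = hess_action f.
   Parameters: al = alpha, g = gamma, lam = lambda, om = omega, gt = gamma tilde. *)

definition A_map ::
  "(real^'n \<Rightarrow> real) \<Rightarrow> real \<Rightarrow> real \<Rightarrow> (real \<Rightarrow> real) \<Rightarrow> (real \<Rightarrow> real) \<Rightarrow>
   (real^'n \<Rightarrow> real^'n \<Rightarrow> real^'n) \<Rightarrow> real \<Rightarrow> real^'n \<Rightarrow> real^'n \<Rightarrow> real^'n" where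
  "A_map f al g lam om H t x v =
     x + (g * (1 - al * g / t)) *\<^sub>R v - (g * lam t) *\<^sub>R H x v - om t *\<^sub>R grad f x"

definition IGAHD_solution ::
  "(real^'n \<Rightarrow> real) \<Rightarrow> real \<Rightarrow> real \<Rightarrow> (real \<Rightarrow> real) \<Rightarrow> (real \<Rightarrow> real) \<Rightarrow> (real \<Rightarrow> real) \<Rightarrow>
   real set \<Rightarrow> (real \<Rightarrow> real^'n) \<Rightarrow> bool" where
  "IGAHD_solution f al g lam om gt T x \<longleftrightarrow>
     (\<exists>v a. \<forall>t\<in>T. (x has_vector_derivative v t) (at t) \<and> (v has_vector_derivative a t) (at t) \<and>
        a t + (al / t) *\<^sub>R v t + (lam t / g) *\<^sub>R hess_action f (x t) (v t) =
          - ((1 / g\<^sup>2) * (om t - gt t)) *\<^sub>R grad f (x t)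
          - grad f (A_map f al g lam om (hess_action f) t (x t) (v t)))"

definition P1_field ::
  "(real^'n \<Rightarrow> real) \<Rightarrow> real \<Rightarrow> real \<Rightarrow> (real \<Rightarrow> real) \<Rightarrow> (real \<Rightarrow> real) \<Rightarrow> (real \<Rightarrow> real) \<Rightarrow>
   (real^'n \<Rightarrow> real^'n \<Rightarrow> real^'n) \<Rightarrow> real \<Rightarrow> (real^'n) \<times> (real^'n) \<Rightarrow> (real^'n) \<times> (real^'n)" where
  "P1_field f al g lam om gt H t = (\<lambda>(x, v).
     (0, - (al / t) *\<^sub>R v - (lam t / g) *\<^sub>R H x v - (om t / g\<^sup>2) *\<^sub>R grad f x
         + (gt t / g\<^sup>2) *\<^sub>R grad f x - grad f (A_map f al g lam om H t x v) + grad f x))"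

definition P2_field ::
  "(real^'n \<Rightarrow> real) \<Rightarrow> real \<Rightarrow> (real^'n) \<times> (real^'n) \<Rightarrow> (real^'n) \<times> (real^'n)" where
  "P2_field f t = (\<lambda>(x, v). (v, - grad f x))"

definition ode_solution ::
  "(real \<Rightarrow> 'a \<Rightarrow> 'a::real_normed_vector) \<Rightarrow> real set \<Rightarrow> (real \<Rightarrow> 'a) \<Rightarrow> bool" where
  "ode_solution F T z \<longleftrightarrow> (\<forall>t\<in>T. (z has_vector_derivative F t (z t)) (at t))"

definition forward_euler ::
  "(real \<Rightarrow> 'a \<Rightarrow> 'a::real_vector) \<Rightarrow> real \<Rightarrow> real \<Rightarrow> 'a \<Rightarrow> 'a" where
  "forward_euler F h t z = z + h *\<^sub>R F t z"

(* One symplectic Euler step for z = (x, v): the field is evaluated at the old position and the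
   new velocity. This is implicit in general, hence a relation; for P2_field it is explicit. *)
definition symplectic_euler ::
  "(real \<Rightarrow> 'a \<times> 'a \<Rightarrow> 'a \<times> 'a::real_vector) \<Rightarrow> real \<Rightarrow> real \<Rightarrow> 'a \<times> 'a \<Rightarrow> 'a \<times> 'a \<Rightarrow> bool" where
  "symplectic_euler F h t z z' \<longleftrightarrow>
     snd z' = snd z + h *\<^sub>R snd (F t (fst z, snd z')) \<and>
     fst z' = fst z + h *\<^sub>R fst (F t (fst z, snd z'))"

(* The Lie-Trotter scheme with gamma = h. The entry v 0 is unused. *)
definition LT_S_IGAHD ::
  "(real^'n \<Rightarrow> real) \<Rightarrow> real \<Rightarrow> real \<Rightarrow> (real \<Rightarrow> real) \<Rightarrow> (real \<Rightarrow> real) \<Rightarrow> (real \<Rightarrow> real) \<Rightarrow>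
   (nat \<Rightarrow> real^'n) \<Rightarrow> (nat \<Rightarrow> real^'n) \<Rightarrow> bool" where
  "LT_S_IGAHD f al h lam om gt x v \<longleftrightarrow>
     v 1 = (1 / h) *\<^sub>R (x 1 - x 0) \<and>
     (\<forall>n\<ge>1.
        let t = real n * h;
            H = (\<lambda>_ _. (1 / h) *\<^sub>R (grad f (x n) - grad f (x (n - 1))));
            z_half = forward_euler (P1_field f al h lam om gt H) h t (x n, v n)
        in symplectic_euler (P2_field f) h t z_half (x (n + 1), v (n + 1)))"

end

theory Submission
  imports Defs
begin

(* Along the scheme h v_n is the increment x_n - x_{n-1}, so y_n is the value of the map A at
   (t_n, x_n, v_n) with the Hessian action replaced by the gradient difference. In the position
   update the gradient of f at x_n added by the Euler step for (P_1) cancels the one subtracted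
   by the symplectic step for (P_2). *)

lemma has_vector_derivative_Pair_iff:
  "((\<lambda>t. (x t, v t)) has_vector_derivative (p, q)) (at t within S) \<longleftrightarrow>
   (x has_vector_derivative p) (at t within S) \<and> (v has_vector_derivative q) (at t within S)"
proof
  assume *: "((\<lambda>t. (x t, v t)) has_vector_derivative (p, q)) (at t within S)"
  show "(x has_vector_derivative p) (at t within S) \<and> (v has_vector_derivative q) (at t within S)"
    using bounded_linear.has_vector_derivative[OF bounded_linear_fst *]
      bounded_linear.has_vector_derivative[OF bounded_linear_snd *] by simp
qed (auto intro: has_vector_derivative_Pair)

text \<open>This is the usual reduction to first order. \<open>P1_field\<close> contributes nothing
  to the position, so the first component forces \<open>v\<close> to be the derivative of
  \<open>x\<close>. In the second component the two copies of the gradient at \<open>x t\<close>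
  cancel, which leaves the second order equation solved for the acceleration.\<close>

lemma IGAHD_solution_iff_split:
  "IGAHD_solution f al h lam om gt T x \<longleftrightarrow>
   (\<exists>v. ode_solution (\<lambda>t z. P1_field f al h lam om gt (hess_action f) t z + P2_field f t z)
      T (\<lambda>t. (x t, v t)))"
proof -
  define rhs where "rhs t w =
      - (al / t) *\<^sub>R w - (lam t / h) *\<^sub>R hess_action f (x t) w
      - (1 / h\<^sup>2 * (om t - gt t)) *\<^sub>R grad f (x t)
      - grad f (A_map f al h lam om (hess_action f) t (x t) w)" for t w
  have field: "P1_field f al h lam om gt (hess_action f) t (x t, w) + P2_field f t (x t, w)
      = (w, rhs t w)" for t w
    by (simp add: P1_field_def P2_field_def rhs_def diff_divide_distrib scaleR_diff_left)
  have force: "a + (al / t) *\<^sub>R w + (lam t / h) *\<^sub>R hess_action f (x t) w =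
        - (1 / h\<^sup>2 * (om t - gt t)) *\<^sub>R grad f (x t)
        - grad f (A_map f al h lam om (hess_action f) t (x t) w) \<longleftrightarrow> a = rhs t w" for a t w
  proof -
    \<comment> \<open>Stated for arbitrary vectors, so that the rearrangement is pure group
      arithmetic and the scaled terms stay opaque.\<close>
    have "a + p + q = - r - s \<longleftrightarrow> a = - p - q - r - s" for p q r s
      unfolding eq_diff_eq eq_neg_iff_add_eq_0 by (simp only: ac_simps)
    then show ?thesis
      unfolding rhs_def scaleR_minus_left by blast
  qed
  show ?thesis
    unfolding IGAHD_solution_def ode_solution_def field has_vector_derivative_Pair_iff force
  proof (intro iffI; elim exE)
    fix v
    assume "\<forall>t\<in>T. (x has_vector_derivative v t) (at t) \<and>
      (v has_vector_derivative rhs t (v t)) (at t)"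
    then show "\<exists>v a. \<forall>t\<in>T. (x has_vector_derivative v t) (at t) \<and>
      (v has_vector_derivative a t) (at t) \<and> a t = rhs t (v t)"
      by (intro exI[of _ v] exI[of _ "\<lambda>t. rhs t (v t)"]) simp
  qed metis
qed

text \<open>Scaling the velocity by \<open>h\<close> clears every denominator: the Euler step
  supplies a second factor \<open>h\<close>, which absorbs the \<open>h\<^sup>2\<close> under
  \<open>om\<close> and \<open>gt\<close> and the two factors \<open>1 / h\<close> at the difference
  of gradients, while \<open>h * (al / t)\<close> is \<open>al / n\<close> at
  \<open>t = n * h\<close>.\<close>

lemma LT_S_IGAHD_step:
  assumes "LT_S_IGAHD f al h lam om gt x v" and "h > 0" and "n \<ge> 1"
  shows "x (n + 1) = x n + h *\<^sub>R v (n + 1)"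
    and "h *\<^sub>R v (n + 1) = (1 - al / real n) *\<^sub>R (h *\<^sub>R v n)
           - lam (real n * h) *\<^sub>R (grad f (x n) - grad f (x (n - 1)))
           - om (real n * h) *\<^sub>R grad f (x n) + gt (real n * h) *\<^sub>R grad f (x n)
           - h\<^sup>2 *\<^sub>R grad f (A_map f al h lam om
               (\<lambda>_ _. (1 / h) *\<^sub>R (grad f (x n) - grad f (x (n - 1)))) (real n * h) (x n) (v n))"
proof -
  let ?d = "grad f (x n) - grad f (x (n - 1))"
  let ?t = "real n * h"
  let ?G = "grad f (A_map f al h lam om (\<lambda>_ _. (1 / h) *\<^sub>R ?d) ?t (x n) (v n))"
  \<comment> \<open>The half step keeps the position, so both subproblems evaluate the gradient at
    the same point \<open>x n\<close>.\<close>
  have step: "v (n + 1) = v n + h *\<^sub>R (- (al / ?t) *\<^sub>R v n - (lam ?t / h) *\<^sub>R (1 / h) *\<^sub>R ?d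
        - (om ?t / h\<^sup>2) *\<^sub>R grad f (x n) + (gt ?t / h\<^sup>2) *\<^sub>R grad f (x n) - ?G + grad f (x n))
        - h *\<^sub>R grad f (x n)"
    and "x (n + 1) = x n + h *\<^sub>R v (n + 1)"
    using assms(1,3)
    by (simp_all add: LT_S_IGAHD_def Let_def symplectic_euler_def forward_euler_def
        P1_field_def P2_field_def)
  then show "x (n + 1) = x n + h *\<^sub>R v (n + 1)" by blast
  have "h \<noteq> 0" "real n \<noteq> 0"
    using assms by auto
  then show "h *\<^sub>R v (n + 1) = (1 - al / real n) *\<^sub>R (h *\<^sub>R v n) - lam ?t *\<^sub>R ?d
      - om ?t *\<^sub>R grad f (x n) + gt ?t *\<^sub>R grad f (x n) - h\<^sup>2 *\<^sub>R ?G"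
    unfolding step
    by (simp add: scaleR_add_right scaleR_diff_right scaleR_diff_left power2_eq_square algebra_simps)
qed

text \<open>For \<open>n = 1\<close> this is the prescribed initial velocity; for larger
  \<open>n\<close> it is the position update of the preceding step, whose index \<open>n - 1\<close>
  is then at least 1.\<close>

lemma LT_S_IGAHD_velocity:
  assumes "LT_S_IGAHD f al h lam om gt x v" and "h > 0" and "n \<ge> 1"
  shows "h *\<^sub>R v n = x n - x (n - 1)"
proof (cases "n = 1")
  case True
  then show ?thesis
    using assms by (simp add: LT_S_IGAHD_def)
next
  case False
  with \<open>n \<ge> 1\<close> have "n - 1 \<ge> 1" "n - 1 + 1 = n" by auto
  then show ?thesis
    using LT_S_IGAHD_step(1)[OF assms(1,2), of "n - 1"] by simp
qed

theorem theorem7: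
  fixes f :: "real^'n \<Rightarrow> real"
    and \<alpha> h :: real
    and lam om gt :: "real \<Rightarrow> real"
  assumes "C2 f" and "h > 0"
  shows "(\<forall>T x. open T \<and> T \<subseteq> {0<..} \<longrightarrow>
            (IGAHD_solution f \<alpha> h lam om gt T x \<longleftrightarrow>
             (\<exists>v. ode_solution
                (\<lambda>t z. P1_field f \<alpha> h lam om gt (hess_action f) t z + P2_field f t z)
                T (\<lambda>t. (x t, v t)))))
       \<and> (\<forall>x v. LT_S_IGAHD f \<alpha> h lam om gt x v \<longrightarrow>
            (\<exists>y. \<forall>n\<ge>1.
               y n = x n + (1 - \<alpha> / real n) *\<^sub>R (x n - x (n - 1))
                   - lam (real n * h) *\<^sub>R (grad f (x n) - grad f (x (n - 1)))
                   - om (real n * h) *\<^sub>R grad f (x n) \<and>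
               x (n + 1) = y n - h\<^sup>2 *\<^sub>R grad f (y n) + gt (real n * h) *\<^sub>R grad f (x n)))"
proof (intro conjI allI impI)
  fix T x
  show "IGAHD_solution f \<alpha> h lam om gt T x \<longleftrightarrow>
      (\<exists>v. ode_solution
        (\<lambda>t z. P1_field f \<alpha> h lam om gt (hess_action f) t z + P2_field f t z)
        T (\<lambda>t. (x t, v t)))"
    by (rule IGAHD_solution_iff_split)
next
  fix x v
  assume scheme: "LT_S_IGAHD f \<alpha> h lam om gt x v"
  let ?d = "\<lambda>n. grad f (x n) - grad f (x (n - 1))"
  \<comment> \<open>Defining \<open>y\<close> through \<open>A_map\<close> lets the gradient in the
    step lemma fold to \<open>grad f (y n)\<close>; the explicit formula is derived
    afterwards.\<close>
  define y where "y n = A_map f \<alpha> h lam om (\<lambda>_ _. (1 / h) *\<^sub>R ?d n) (real n * h) (x n) (v n)" for n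
  have y: "y n = x n + (1 - \<alpha> / real n) *\<^sub>R (x n - x (n - 1)) - lam (real n * h) *\<^sub>R ?d n
      - om (real n * h) *\<^sub>R grad f (x n)" if "n \<ge> 1" for n
  proof -
    have "(h * (1 - \<alpha> * h / (real n * h))) *\<^sub>R v n = (1 - \<alpha> / real n) *\<^sub>R (h *\<^sub>R v n)"
      using \<open>h > 0\<close> by (simp add: mult.commute)
    then show ?thesis
      using \<open>h > 0\<close> LT_S_IGAHD_velocity[OF scheme \<open>h > 0\<close> that] by (simp add: y_def A_map_def)
  qed
  \<comment> \<open>In \<open>x n + h *\<^sub>R v (n + 1)\<close> the inertial, difference and
    \<open>om\<close> terms together with \<open>x n\<close> make up \<open>y n\<close>.\<close>
  have "x (n + 1) = y n - h\<^sup>2 *\<^sub>R grad f (y n) + gt (real n * h) *\<^sub>R grad f (x n)"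
    if "n \<ge> 1" for n
    using LT_S_IGAHD_step[OF scheme \<open>h > 0\<close> that, folded y_def]
      LT_S_IGAHD_velocity[OF scheme \<open>h > 0\<close> that] y[OF that] by simp
  with y show "\<exists>y. \<forall>n\<ge>1.
      y n = x n + (1 - \<alpha> / real n) *\<^sub>R (x n - x (n - 1))
          - lam (real n * h) *\<^sub>R (grad f (x n) - grad f (x (n - 1)))
          - om (real n * h) *\<^sub>R grad f (x n) \<and>
      x (n + 1) = y n - h\<^sup>2 *\<^sub>R grad f (y n) + gt (real n * h) *\<^sub>R grad f (x n)"
    by blast
qed

end
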